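(* Let $\mathcal{N}$ be a finite node set. A strictly positive probability distribution $P$ on $\mathcal{G}_{\mathcal{N}}$ is exchangeable if and only if there is $\nu=(\nu_U)_{U\in\mathcal{U}_{\mathcal{N}}\setminus\{\varnothing\}}\in\mathbb{R}^{\mathcal{U}_{\mathcal{N}}\setminus\{\varnothing\}}$ such that $$P(x)=\exp\Big\{\sum_{U\in\mathcal{U}_{\mathcal{N}}\setminus\{\varnothing\}}\sigma_U(x)\,\nu_U-\psi(\nu)\Big\},\qquad x\in\mathcal{G}_{\mathcal{N}},$$ where $\psi(\nu)$ is the normalizing constant (log-partition function). Thus the strictly positive exchangeable distributions form a linear and regular exponential family with canonical sufficient statistics $(\sigma_U)_{U\neq\varnothing}$ and canonical parameters $(\nu_U)_{U\neq\varnothing}$, and its mean value parameters are $$\mathrm{E}\{\sigma_U(X)\}=\frac{\mathrm{inj}(U,K_{\mathcal{N}})}{\mathrm{inj}(U,U)}\,z_U,\qquad U\in\mathcal{U}_{\mathcal{N}}\setminus\{\varnothing\}.$$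
   Context: $\mathcal{G}_{\mathcal{N}}$ is the set of all simple, undirected, labeled graphs with node set $\mathcal{N}$; a random network $X$ on $\mathcal{N}$ is a $\mathcal{G}_{\mathcal{N}}$-valued random variable (equivalently, a family of binary variables $X_{ij}$ indexed by unordered pairs, or dyads, $ij$ of distinct nodes). A distribution $P$ on $\mathcal{G}_{\mathcal{N}}$ is exchangeable if $P(x)=P(x')$ whenever $x$ and $x'$ are isomorphic. $\mathcal{U}_{\mathcal{N}}$ is the set of unlabeled graphs on $\mathcal{N}$, i.e. of isomorphism classes of $\mathcal{G}_{\mathcal{N}}$; $[U]\subseteq\mathcal{G}_{\mathcal{N}}$ is the isomorphism class of $U$, and $\varnothing$ is the graph with no edges. $B\subseteq x$ means every edge of $B$ is an edge of $x$. $\sigma_U(x)$ is the number of graphs $B\in[U]$ with $B\subseteq x$. For exchangeable $X$, $z_U=\mathbb{P}(B\subseteq X)$ for any $B\in[U]$. $K_{\mathcal{N}}$ is the complete graph on $\mathcal{N}$; $\mathrm{inj}(F,G)$ is the number of injective graph homomorphisms from $F$ to $G$ (injective vertex maps sending edges to edges). The quantity $\mathrm{inj}(U,K_{\mathcal{N}})/\mathrm{inj}(U,U)$ is the number of subgraphs of $K_{\mathcal{N}}$ isomorphic to $U$; here, in forming $\mathrm{inj}$, $U$ is represented by a graph without isolated nodes. *)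

theory Defs
  imports "HOL-Probability.Probability"
begin

text \<open>A labeled graph on a fixed node set is identified with its set of edges, an edge being
  a dyad, i.e. a two-element set of nodes.\<close>

type_synonym 'a graph = "'a set set"

definition dyads :: "'a set \<Rightarrow> 'a set set" where
  "dyads N = {e. e \<subseteq> N \<and> card e = 2}"

definition graphs :: "'a set \<Rightarrow> 'a graph set" where
  "graphs N = Pow (dyads N)"

definition iso_rel :: "'a set \<Rightarrow> ('a graph \<times> 'a graph) set" where
  "iso_rel N = {(x, y). x \<in> graphs N \<and> y \<in> graphs N \<and>
      (\<exists>\<pi>. bij_betw \<pi> N N \<and> y = (\<lambda>e. \<pi> ` e) ` x)}"

text \<open>An unlabeled graph is an isomorphism class, so \<open>[U]\<close> is \<open>U\<close> itself.\<close>

definition unlabeled_graphs :: "'a set \<Rightarrow> 'a graph set set" where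
  "unlabeled_graphs N = graphs N // iso_rel N"

definition nonempty_unlabeled_graphs :: "'a set \<Rightarrow> 'a graph set set" where
  "nonempty_unlabeled_graphs N = unlabeled_graphs N - {iso_rel N `` {{}}}"

definition subgraph_count :: "'a graph set \<Rightarrow> 'a graph \<Rightarrow> nat" where
  "subgraph_count U x = card {B \<in> U. B \<subseteq> x}"

text \<open>Here node sets matter, so graphs are pairs of a node set and an edge set. Homomorphisms are
  extensional outside the source node set; for an injective map, the image of an edge
  \<open>{u, v}\<close> is the pair \<open>{f u, f v}\<close> of distinct nodes.\<close>

definition inj_hom_count :: "'a set \<times> 'a graph \<Rightarrow> 'b set \<times> 'b graph \<Rightarrow> nat" where
  "inj_hom_count F G =
     card {f \<in> fst F \<rightarrow>\<^sub>E fst G. inj_on f (fst F) \<and> (\<forall>e \<in> snd F. f ` e \<in> snd G)}"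

definition without_isolated :: "'a graph \<Rightarrow> 'a set \<times> 'a graph" where
  "without_isolated B = (\<Union>B, B)"

definition complete_graph_on :: "'a set \<Rightarrow> 'a set \<times> 'a graph" where
  "complete_graph_on N = (N, dyads N)"

definition exchangeable :: "'a set \<Rightarrow> 'a graph pmf \<Rightarrow> bool" where
  "exchangeable N P \<longleftrightarrow> (\<forall>(x, y) \<in> iso_rel N. pmf P x = pmf P y)"

definition positive_exchangeable :: "'a set \<Rightarrow> 'a graph pmf set" where
  "positive_exchangeable N = {P. set_pmf P = graphs N \<and> exchangeable N P}"

text \<open>\<open>S\<close> is a (countable) sample space with counting measure as reference measure, \<open>I\<close> a finite
  index set, \<open>t i\<close> the canonical statistics. The space of real vectors indexed by \<open>I\<close>
  is the set of extensional functions \<open>I \<rightarrow>\<^sub>E UNIV\<close>, the carrier of \<open>powertop_real I\<close>.\<close>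

definition log_partition ::
    "'x set \<Rightarrow> 'i set \<Rightarrow> ('i \<Rightarrow> 'x \<Rightarrow> real) \<Rightarrow> ('i \<Rightarrow> real) \<Rightarrow> real" where
  "log_partition S I t \<nu> = ln (\<Sum>\<^sub>\<infinity>x\<in>S. exp (\<Sum>i\<in>I. t i x * \<nu> i))"

definition natural_parameter_space ::
    "'x set \<Rightarrow> 'i set \<Rightarrow> ('i \<Rightarrow> 'x \<Rightarrow> real) \<Rightarrow> ('i \<Rightarrow> real) set" where
  "natural_parameter_space S I t =
     {\<nu> \<in> I \<rightarrow>\<^sub>E UNIV. (\<lambda>x. exp (\<Sum>i\<in>I. t i x * \<nu> i)) summable_on S}"

definition exponential_family ::
    "'x set \<Rightarrow> 'i set \<Rightarrow> ('i \<Rightarrow> 'x \<Rightarrow> real) \<Rightarrow> ('i \<Rightarrow> real) set \<Rightarrow> 'x pmf set \<Rightarrow> bool" where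
  "exponential_family S I t \<Theta> \<P> \<longleftrightarrow>
     finite I \<and> \<Theta> \<noteq> {} \<and> \<Theta> \<subseteq> natural_parameter_space S I t \<and>
     \<P> = {P. set_pmf P = S \<and>
             (\<exists>\<nu>\<in>\<Theta>. \<forall>x\<in>S. pmf P x = exp ((\<Sum>i\<in>I. t i x * \<nu> i) - log_partition S I t \<nu>))}"

text \<open>Linear (as opposed to curved): the canonical parameters range over a linear subspace,
  so that the log-densities, modulo constants, form a linear space.\<close>

definition linear_exponential_family ::
    "'x set \<Rightarrow> 'i set \<Rightarrow> ('i \<Rightarrow> 'x \<Rightarrow> real) \<Rightarrow> ('i \<Rightarrow> real) set \<Rightarrow> 'x pmf set \<Rightarrow> bool" where
  "linear_exponential_family S I t \<Theta> \<P> \<longleftrightarrow>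
     exponential_family S I t \<Theta> \<P> \<and>
     (\<lambda>i\<in>I. 0) \<in> \<Theta> \<and>
     (\<forall>\<nu>\<in>\<Theta>. \<forall>\<nu>'\<in>\<Theta>. (\<lambda>i\<in>I. \<nu> i + \<nu>' i) \<in> \<Theta>) \<and>
     (\<forall>c. \<forall>\<nu>\<in>\<Theta>. (\<lambda>i\<in>I. c * \<nu> i) \<in> \<Theta>)"

text \<open>Regular: full with open natural parameter space, in a minimal representation (the constant
  function and the canonical statistics are linearly independent).\<close>

definition regular_exponential_family ::
    "'x set \<Rightarrow> 'i set \<Rightarrow> ('i \<Rightarrow> 'x \<Rightarrow> real) \<Rightarrow> ('i \<Rightarrow> real) set \<Rightarrow> 'x pmf set \<Rightarrow> bool" where
  "regular_exponential_family S I t \<Theta> \<P> \<longleftrightarrow>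
     exponential_family S I t \<Theta> \<P> \<and>
     \<Theta> = natural_parameter_space S I t \<and>
     openin (powertop_real I) \<Theta> \<and>
     (\<forall>c b. (\<forall>x\<in>S. (\<Sum>i\<in>I. c i * t i x) = b) \<longrightarrow> (\<forall>i\<in>I. c i = 0))"

end

theory Submission
  imports Defs
begin

text \<open>The dictionary behind the theorem is Moebius inversion on the subset lattice of the dyads.
  Every real function \<open>f\<close> on graphs is \<open>f x = (\<Sum>B \<subseteq> x. h B)\<close> for exactly one \<open>h\<close>, and since relabelling
  the nodes is an automorphism of the lattice, \<open>f\<close> is invariant under isomorphism if and only if
  \<open>h\<close> is. For invariant \<open>h\<close>, collecting the terms by isomorphism class turns the sum into
  \<open>h {} + (\<Sum>U. \<sigma>\<^sub>U x * h\<^sub>U)\<close>. Hence the functions \<open>1\<close> and \<open>\<sigma>\<^sub>U\<close>, with \<open>U\<close> nonempty, form a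
  basis of the invariant functions.

  A positive \<open>P\<close> is exchangeable exactly when \<open>ln P\<close> is invariant, so spanning
  (\<open>invariant_moebius_expansion\<close>) gives the exponential form, the constant term being forced by
  normalization, while linear independence (\<open>subgraph_counts_affinely_independent\<close>) gives
  minimality. As there are only finitely many graphs, every parameter vector is admissible, so
  the natural parameter space is the full vector space.

  For the mean values, \<open>\<sigma>\<^sub>U\<close> is the sum over \<open>C \<in> U\<close> of the indicators of \<open>C \<subseteq> X\<close>, and these events are
  equiprobable, so the mean is \<open>card U * z\<^sub>U\<close>. The size of \<open>U\<close> comes from orbit counting
  (\<open>card_iso_class\<close>): each injection of the non-isolated nodes of \<open>B\<close> into \<open>N\<close> carries \<open>B\<close> to a member
  of its class, and each member is hit by as many injections as \<open>B\<close> has automorphisms.\<close>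

section \<open>Relabelling graphs\<close>

lemma finite_graphs: "finite N \<Longrightarrow> finite (graphs N)"
  by (simp add: graphs_def dyads_def)

lemma empty_in_graphs: "{} \<in> graphs N"
  by (simp add: graphs_def)

lemma finite_graph: "finite N \<Longrightarrow> x \<in> graphs N \<Longrightarrow> finite x"
  by (auto simp: graphs_def dyads_def intro: finite_subset)

lemma subgraph_in_graphs: "x \<in> graphs N \<Longrightarrow> B \<subseteq> x \<Longrightarrow> B \<in> graphs N"
  by (auto simp: graphs_def)

lemma Union_graph_subset: "x \<in> graphs N \<Longrightarrow> \<Union>x \<subseteq> N"
  by (auto simp: graphs_def dyads_def)

lemma relabel_dyads:
  assumes "bij_betw \<pi> N N"
  shows "bij_betw ((`) \<pi>) (dyads N) (dyads N)"
proof -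
  have *: "(`) \<pi> ` dyads N = dyads N"
  proof (intro equalityI subsetI)
    fix d assume "d \<in> (`) \<pi> ` dyads N"
    then obtain e where "e \<subseteq> N" "card e = 2" "d = \<pi> ` e"
      by (auto simp: dyads_def)
    moreover from this assms have "inj_on \<pi> e" "\<pi> ` e \<subseteq> N"
      by (auto simp: bij_betw_def inj_on_def) blast
    ultimately show "d \<in> dyads N"
      by (simp add: dyads_def card_image)
  next
    fix d assume d: "d \<in> dyads N"
    then have "d \<subseteq> \<pi> ` N"
      using assms by (auto simp: dyads_def bij_betw_def)
    then obtain e where e: "e \<subseteq> N" "d = \<pi> ` e"
      by (auto simp: subset_image_iff)
    have "inj_on \<pi> e"
      using e(1) assms by (auto simp: bij_betw_def inj_on_def)
    then have "card e = 2"
      using d e(2) by (simp add: dyads_def card_image)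
    with e show "d \<in> (`) \<pi> ` dyads N"
      by (auto simp: dyads_def)
  qed
  have "bij_betw ((`) \<pi>) (Pow N) (Pow N)"
    using assms by (rule bij_betw_Pow)
  then have "inj_on ((`) \<pi>) (Pow N)"
    by (simp add: bij_betw_def)
  then have "inj_on ((`) \<pi>) (dyads N)"
    by (rule inj_on_subset) (auto simp: dyads_def)
  with * show ?thesis
    by (simp add: bij_betw_def)
qed

lemma inj_on_relabel:
  assumes "bij_betw \<pi> N N" "x \<in> graphs N"
  shows "inj_on ((`) \<pi>) x"
proof (rule inj_on_subset)
  show "inj_on ((`) \<pi>) (dyads N)"
    using relabel_dyads[OF assms(1)] by (simp add: bij_betw_def)
  show "x \<subseteq> dyads N"
    using assms(2) by (simp add: graphs_def)
qed

lemma relabel_graphs: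
  assumes "bij_betw \<pi> N N"
  shows "bij_betw ((`) ((`) \<pi>)) (graphs N) (graphs N)"
  unfolding graphs_def by (intro bij_betw_Pow relabel_dyads assms)

lemma relabel_in_graphs:
  "bij_betw \<pi> N N \<Longrightarrow> x \<in> graphs N \<Longrightarrow> (`) \<pi> ` x \<in> graphs N"
  using relabel_graphs[of \<pi> N] by (auto simp: bij_betw_def)

lemma relabel_subset_iff:
  assumes "bij_betw \<pi> N N" "B \<in> graphs N" "x \<in> graphs N"
  shows "(`) \<pi> ` B \<subseteq> (`) \<pi> ` x \<longleftrightarrow> B \<subseteq> x"
  using assms relabel_dyads[OF assms(1)]
  by (intro inj_on_image_subset_iff[of _ "dyads N"]) (auto simp: graphs_def bij_betw_def)

lemma card_relabel:
  assumes "bij_betw \<pi> N N" "x \<in> graphs N"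
  shows "card ((`) \<pi> ` x) = card x"
  using inj_on_relabel[OF assms] by (rule card_image)

lemma iso_relI:
  "bij_betw \<pi> N N \<Longrightarrow> x \<in> graphs N \<Longrightarrow> (x, (`) \<pi> ` x) \<in> iso_rel N"
  by (auto simp: iso_rel_def relabel_in_graphs)

lemma iso_relE:
  assumes "(x, y) \<in> iso_rel N"
  obtains \<pi> where "bij_betw \<pi> N N" "x \<in> graphs N" "y = (`) \<pi> ` x"
  using assms by (auto simp: iso_rel_def)

lemma equiv_iso_rel: "equiv (graphs N) (iso_rel N)"
proof (rule equivI)
  show "iso_rel N \<subseteq> graphs N \<times> graphs N"
    by (auto simp: iso_rel_def)
  show "refl_on (graphs N) (iso_rel N)"
  proof (rule refl_onI)
    fix x assume "x \<in> graphs N"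
    from iso_relI[OF bij_betw_id this] show "(x, x) \<in> iso_rel N"
      by simp
  qed
  show "sym (iso_rel N)"
  proof (rule symI)
    fix x y assume "(x, y) \<in> iso_rel N"
    then obtain \<pi> where pi: "bij_betw \<pi> N N" "x \<in> graphs N" "y = (`) \<pi> ` x"
      by (rule iso_relE)
    have "inv_into N \<pi> ` \<pi> ` e = e" if "e \<in> x" for e
      using that pi Union_graph_subset[OF pi(2)]
      by (intro inv_into_image_cancel) (auto simp: bij_betw_def)
    then have "(`) (inv_into N \<pi>) ` y = x"
      by (simp add: pi(3) image_image)
    with iso_relI[OF bij_betw_inv_into[OF pi(1)] relabel_in_graphs[OF pi(1,2)]]
    show "(y, x) \<in> iso_rel N"
      by (simp add: pi(3))
  qed
  show "trans (iso_rel N)"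
  proof (rule transI)
    fix x y z assume "(x, y) \<in> iso_rel N" "(y, z) \<in> iso_rel N"
    then obtain \<pi> \<rho> where "bij_betw \<pi> N N" "x \<in> graphs N" "y = (`) \<pi> ` x"
        "bij_betw \<rho> N N" "z = (`) \<rho> ` y"
      by (meson iso_relE)
    with iso_relI[OF bij_betw_trans[of \<pi> N N \<rho> N], of x]
    show "(x, z) \<in> iso_rel N"
      by (simp add: image_comp o_def image_image)
  qed
qed

lemma iso_class_empty: "iso_rel N `` {{}} = {{}}"
  using equiv_class_self[OF equiv_iso_rel empty_in_graphs, of N] by (auto simp: iso_rel_def)

lemma finite_nonempty_unlabeled_graphs: "finite N \<Longrightarrow> finite (nonempty_unlabeled_graphs N)"
  unfolding nonempty_unlabeled_graphs_def unlabeled_graphs_def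
  by (intro finite_Diff finite_quotient) (auto simp: finite_graphs iso_rel_def)

lemma nonempty_unlabeled_graphs_class:
  assumes "U \<in> nonempty_unlabeled_graphs N" "B \<in> U"
  shows "B \<in> graphs N" "B \<noteq> {}" "U = iso_rel N `` {B}"
proof -
  have U: "U \<in> graphs N // iso_rel N" "U \<noteq> iso_rel N `` {{}}"
    using assms by (auto simp: nonempty_unlabeled_graphs_def unlabeled_graphs_def)
  then show B: "B \<in> graphs N"
    using assms(2) equiv_iso_rel by (meson in_quotient_imp_subset subsetD)
  show "U = iso_rel N `` {B}"
    using U(1) assms(2) equiv_class_eq[OF equiv_iso_rel, of _ B] by (auto elim!: quotientE)
  with U(2) show "B \<noteq> {}"
    by auto
qed

lemma class_in_nonempty_unlabeled_graphs:
  assumes "B \<in> graphs N" "B \<noteq> {}"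
  shows "iso_rel N `` {B} \<in> nonempty_unlabeled_graphs N"
  using assms equiv_class_self[OF equiv_iso_rel assms(1)]
  by (auto simp: nonempty_unlabeled_graphs_def unlabeled_graphs_def iso_class_empty
      intro: quotientI)

section \<open>Subgraph counts and invariant functions\<close>

text \<open>This passes between sums over classes, as they occur in the theorem, and sums over all
  nonempty subgraphs, to which Moebius inversion applies.\<close>

lemma sum_subgraph_count:
  fixes c :: "'a graph set \<Rightarrow> real"
  assumes "finite N" "x \<in> graphs N"
  shows "(\<Sum>U\<in>nonempty_unlabeled_graphs N. real (subgraph_count U x) * c U)
       = (\<Sum>B\<in>Pow x - {{}}. c (iso_rel N `` {B}))"
proof -
  let ?S = "Pow x - {{}}" and ?T = "nonempty_unlabeled_graphs N"
  let ?cl = "\<lambda>B. iso_rel N `` {B}"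
  have fibre: "{B \<in> ?S. ?cl B = U} = {B \<in> U. B \<subseteq> x}" if "U \<in> ?T" for U
    using nonempty_unlabeled_graphs_class[OF that] subgraph_in_graphs[OF assms(2)]
      equiv_class_self[OF equiv_iso_rel]
    by blast
  have "(\<Sum>B\<in>?S. c (?cl B)) = (\<Sum>U\<in>?T. \<Sum>B\<in>{B \<in> ?S. ?cl B = U}. c (?cl B))"
    using assms finite_graph[OF assms]
    by (intro sum.group[symmetric] finite_nonempty_unlabeled_graphs)
       (auto intro!: class_in_nonempty_unlabeled_graphs intro: subgraph_in_graphs)
  also have "\<dots> = (\<Sum>U\<in>?T. \<Sum>B\<in>{B \<in> ?S. ?cl B = U}. c U)"
    by (intro sum.cong) auto
  also have "\<dots> = (\<Sum>U\<in>?T. real (subgraph_count U x) * c U)"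
    using fibre by (intro sum.cong refl) (simp add: subgraph_count_def del: Pow_iff)
  finally show ?thesis ..
qed

text \<open>A relabelling that carries \<open>x\<close> to \<open>y\<close> restricts to a bijection between the copies of \<open>U\<close> in
  \<open>x\<close> and those in \<open>y\<close>, since it maps \<open>U\<close> onto itself.\<close>

lemma subgraph_count_invariant:
  assumes "U \<in> nonempty_unlabeled_graphs N" "(x, y) \<in> iso_rel N"
  shows "subgraph_count U x = subgraph_count U y"
proof -
  from assms(2) obtain \<pi> where pi: "bij_betw \<pi> N N" "x \<in> graphs N" "y = (`) \<pi> ` x"
    by (rule iso_relE)
  let ?r = "(`) ((`) \<pi>)"
  have U: "U \<subseteq> graphs N"
    using nonempty_unlabeled_graphs_class(1)[OF assms(1)] by blast
  have inU: "?r B \<in> U \<longleftrightarrow> B \<in> U" if "B \<in> graphs N" for B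
  proof -
    have r: "(B, ?r B) \<in> iso_rel N"
      using pi(1) that by (rule iso_relI)
    then have "iso_rel N `` {B} = iso_rel N `` {?r B}"
      by (rule equiv_class_eq[OF equiv_iso_rel])
    with r show ?thesis
      using nonempty_unlabeled_graphs_class(3)[OF assms(1)]
        equiv_class_self[OF equiv_iso_rel] that
      by (metis relabel_in_graphs[OF pi(1)])
  qed
  have "bij_betw ?r {B \<in> U. B \<subseteq> x} {B \<in> U. B \<subseteq> y}"
    unfolding bij_betw_def
  proof
    show "inj_on ?r {B \<in> U. B \<subseteq> x}"
    proof (rule inj_on_subset)
      show "inj_on ?r (graphs N)"
        using relabel_graphs[OF pi(1)] by (simp add: bij_betw_def)
    qed (use U in auto)
    show "?r ` {B \<in> U. B \<subseteq> x} = {B \<in> U. B \<subseteq> y}"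
    proof (intro equalityI subsetI)
      fix C assume "C \<in> ?r ` {B \<in> U. B \<subseteq> x}"
      then show "C \<in> {B \<in> U. B \<subseteq> y}"
        using inU U pi(3) by blast
    next
      fix C assume C: "C \<in> {B \<in> U. B \<subseteq> y}"
      then obtain B where "B \<subseteq> x" "C = ?r B"
        by (auto simp: pi(3) subset_image_iff)
      then show "C \<in> ?r ` {B \<in> U. B \<subseteq> x}"
        using C inU subgraph_in_graphs[OF pi(2)] by blast
    qed
  qed
  then show ?thesis
    unfolding subgraph_count_def by (rule bij_betw_same_card)
qed

text \<open>The coefficient of \<open>U\<close> is the Moebius transform of \<open>f\<close> at any member of \<open>U\<close>. The choice of the
  member does not matter, because the transform only involves cardinalities of subgraphs and
  values of \<open>f\<close>, all of which are preserved by relabelling.\<close>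

lemma invariant_moebius_expansion:
  fixes f :: "'a graph \<Rightarrow> real"
  assumes "finite N" and inv: "\<And>x y. (x, y) \<in> iso_rel N \<Longrightarrow> f x = f y"
  obtains \<nu> where "\<nu> \<in> nonempty_unlabeled_graphs N \<rightarrow>\<^sub>E UNIV"
    "\<And>x. x \<in> graphs N \<Longrightarrow>
       f x = f {} + (\<Sum>U\<in>nonempty_unlabeled_graphs N. real (subgraph_count U x) * \<nu> U)"
proof
  \<comment> \<open>The sign is split as \<open>(-1) ^ (card B - card C) = (-1) ^ card B * (-1) ^ card C\<close>, which makes
    the inversion formula symmetric in \<open>m\<close> and \<open>f\<close>.\<close>
  define m where "m B = (\<Sum>C\<in>Pow B. (-1) ^ card C * f C)" for B
  define h where "h B = (-1) ^ card B * m B" for B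
  have inversion: "f x = sum h (Pow x)" if "finite x" for x
    unfolding h_def by (rule inclusion_exclusion_symmetric[OF _ that]) (simp add: m_def)
  have h_inv: "h x = h y" if "(x, y) \<in> iso_rel N" for x y
  proof -
    from that obtain \<pi> where pi: "bij_betw \<pi> N N" "x \<in> graphs N" "y = (`) \<pi> ` x"
      by (rule iso_relE)
    have bij: "bij_betw ((`) ((`) \<pi>)) (Pow x) (Pow y)"
      using inj_on_relabel[OF pi(1,2)] by (intro bij_betw_Pow) (simp add: bij_betw_def pi(3))
    have "m y = (\<Sum>C\<in>Pow x. (-1) ^ card ((`) \<pi> ` C) * f ((`) \<pi> ` C))"
      unfolding m_def by (rule sum.reindex_bij_betw[OF bij, symmetric])
    also have "\<dots> = m x"
      unfolding m_def
    proof (rule sum.cong[OF refl])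
      fix C assume "C \<in> Pow x"
      then have C: "C \<in> graphs N"
        using subgraph_in_graphs[OF pi(2)] by blast
      show "(-1) ^ card ((`) \<pi> ` C) * f ((`) \<pi> ` C) = (-1) ^ card C * f C"
        using card_relabel[OF pi(1) C] inv[OF iso_relI[OF pi(1) C]] by simp
    qed
    finally show ?thesis
      by (simp add: h_def pi(3) card_relabel[OF pi(1,2)])
  qed
  let ?nu = "\<lambda>U\<in>nonempty_unlabeled_graphs N. h (SOME B. B \<in> U)"
  show "?nu \<in> nonempty_unlabeled_graphs N \<rightarrow>\<^sub>E UNIV"
    by auto
  fix x assume x: "x \<in> graphs N"
  have "(\<Sum>U\<in>nonempty_unlabeled_graphs N. real (subgraph_count U x) * ?nu U)
      = (\<Sum>B\<in>Pow x - {{}}. ?nu (iso_rel N `` {B}))"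
    by (rule sum_subgraph_count[OF assms(1) x])
  also have "\<dots> = (\<Sum>B\<in>Pow x - {{}}. h B)"
  proof (rule sum.cong[OF refl])
    fix B assume "B \<in> Pow x - {{}}"
    then have B: "B \<in> graphs N" "B \<noteq> {}"
      using subgraph_in_graphs[OF x] by auto
    have "(SOME C. C \<in> iso_rel N `` {B}) \<in> iso_rel N `` {B}"
      using equiv_class_self[OF equiv_iso_rel B(1)] by (rule someI)
    then show "?nu (iso_rel N `` {B}) = h B"
      using class_in_nonempty_unlabeled_graphs[OF B] h_inv by auto
  qed
  also have "\<dots> = f x - h {}"
    using finite_graph[OF assms(1) x] by (simp add: inversion sum_diff1)
  also have "h {} = f {}"
    using inversion[of "{}"] by simp
  finally show "f x = f {} + (\<Sum>U\<in>nonempty_unlabeled_graphs N. real (subgraph_count U x) * ?nu U)"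
    by simp
qed

text \<open>Evaluating at the empty graph gives \<open>b = 0\<close>. If the coefficients of all proper nonempty
  subgraphs of \<open>B\<close> vanish, then the relation at \<open>x = B\<close> reduces to the coefficient of \<open>B\<close> itself.\<close>

lemma subgraph_counts_affinely_independent:
  assumes "finite N"
    and const: "\<And>x. x \<in> graphs N \<Longrightarrow>
      (\<Sum>U\<in>nonempty_unlabeled_graphs N. c U * real (subgraph_count U x)) = b"
    and U: "U \<in> nonempty_unlabeled_graphs N"
  shows "c U = 0"
proof -
  let ?c = "\<lambda>B. c (iso_rel N `` {B})"
  have sums: "(\<Sum>B\<in>Pow x - {{}}. ?c B) = b" if "x \<in> graphs N" for x
    using const[OF that] sum_subgraph_count[OF assms(1) that, of c]
    by (simp add: mult.commute)
  have "b = 0"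
    using sums[OF empty_in_graphs] by simp
  have zero: "?c B = 0" if "B \<in> graphs N" "B \<noteq> {}" for B
    using finite_graph[OF assms(1) that(1)] that
  proof (induction B rule: finite_psubset_induct)
    case (psubset B)
    have "(\<Sum>C\<in>Pow B - {{}} - {B}. ?c C) = 0"
      using psubset.IH subgraph_in_graphs[OF psubset.prems(1)] by (intro sum.neutral) auto
    then show ?case
      using sums[OF psubset.prems(1)] psubset.hyps psubset.prems(2) \<open>b = 0\<close>
        sum.remove[of "Pow B - {{}}" B ?c]
      by simp
  qed
  obtain B where B: "B \<in> U"
    using U in_quotient_imp_non_empty[OF equiv_iso_rel]
    by (auto simp: nonempty_unlabeled_graphs_def unlabeled_graphs_def)
  show ?thesis
    using zero nonempty_unlabeled_graphs_class[OF U B] by simp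
qed

section \<open>The exponential family\<close>

lemma exchangeableD: "exchangeable N P \<Longrightarrow> (x, y) \<in> iso_rel N \<Longrightarrow> pmf P x = pmf P y"
  by (auto simp: exchangeable_def)

text \<open>Normalization leaves no freedom for the additive constant in the log-density, so it never
  has to be computed.\<close>

lemma pmf_log_partition:
  fixes t :: "'i \<Rightarrow> 'x \<Rightarrow> real"
  assumes "finite S" "set_pmf P = S"
    and P: "\<And>x. x \<in> S \<Longrightarrow> pmf P x = exp (a + (\<Sum>i\<in>I. t i x * \<nu> i))"
    and x: "x \<in> S"
  shows "pmf P x = exp ((\<Sum>i\<in>I. t i x * \<nu> i) - log_partition S I t \<nu>)"
proof -
  let ?Z = "\<Sum>x\<in>S. exp (\<Sum>i\<in>I. t i x * \<nu> i)"
  have "1 = (\<Sum>x\<in>S. pmf P x)"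
    using sum_pmf_eq_1[OF assms(1)] assms(2) by simp
  also have "\<dots> = exp a * ?Z"
    by (simp add: P exp_add sum_distrib_left)
  finally have "?Z = exp (- a)"
    by (simp add: exp_minus field_simps)
  then have "log_partition S I t \<nu> = - a"
    by (simp add: log_partition_def assms(1))
  then show ?thesis
    using P[OF x] by (simp add: add.commute)
qed

lemma exchangeable_iff_exponential_form:
  assumes "finite N" "set_pmf P = graphs N"
  shows "exchangeable N P \<longleftrightarrow>
    (\<exists>\<nu>\<in>nonempty_unlabeled_graphs N \<rightarrow>\<^sub>E UNIV. \<forall>x\<in>graphs N.
       pmf P x = exp ((\<Sum>U\<in>nonempty_unlabeled_graphs N. real (subgraph_count U x) * \<nu> U)
         - log_partition (graphs N) (nonempty_unlabeled_graphs N)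
             (\<lambda>U x. real (subgraph_count U x)) \<nu>))" (is "_ \<longleftrightarrow> ?form")
proof
  assume ex: "exchangeable N P"
  obtain \<nu> where nu: "\<nu> \<in> nonempty_unlabeled_graphs N \<rightarrow>\<^sub>E UNIV"
    and expansion: "\<And>x. x \<in> graphs N \<Longrightarrow> ln (pmf P x) =
       ln (pmf P {}) + (\<Sum>U\<in>nonempty_unlabeled_graphs N. real (subgraph_count U x) * \<nu> U)"
  proof (rule invariant_moebius_expansion[OF assms(1), of "\<lambda>x. ln (pmf P x)"])
    show "ln (pmf P x) = ln (pmf P y)" if "(x, y) \<in> iso_rel N" for x y
      using exchangeableD[OF ex that] by simp
  qed (erule that, blast)
  have "pmf P x = exp (ln (pmf P {}) +
      (\<Sum>U\<in>nonempty_unlabeled_graphs N. real (subgraph_count U x) * \<nu> U))"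
    if "x \<in> graphs N" for x
    using that assms(2) by (simp add: pmf_positive flip: expansion)
  from pmf_log_partition[OF finite_graphs[OF assms(1)] assms(2) this]
  show ?form
    using nu by blast
next
  assume ?form
  then obtain \<nu> a where form: "\<forall>x\<in>graphs N. pmf P x =
      exp ((\<Sum>U\<in>nonempty_unlabeled_graphs N. real (subgraph_count U x) * \<nu> U) - a)"
    by blast
  have "pmf P x = pmf P y" if "(x, y) \<in> iso_rel N" for x y
  proof -
    have "x \<in> graphs N" "y \<in> graphs N"
      using that by (auto simp: iso_rel_def)
    then show ?thesis
      using form subgraph_count_invariant[OF _ that] by simp
  qed
  then show "exchangeable N P"
    by (auto simp: exchangeable_def)
qed

lemma exponential_family_positive_exchangeable:
  assumes "finite N"
  shows "exponential_family (graphs N) (nonempty_unlabeled_graphs N)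
    (\<lambda>U x. real (subgraph_count U x)) (nonempty_unlabeled_graphs N \<rightarrow>\<^sub>E UNIV)
    (positive_exchangeable N)"
  unfolding exponential_family_def
proof (intro conjI)
  show "finite (nonempty_unlabeled_graphs N)"
    by (rule finite_nonempty_unlabeled_graphs[OF assms])
  show "nonempty_unlabeled_graphs N \<rightarrow>\<^sub>E (UNIV :: real set) \<noteq> {}"
    by (simp add: PiE_eq_empty_iff)
  show "nonempty_unlabeled_graphs N \<rightarrow>\<^sub>E UNIV
      \<subseteq> natural_parameter_space (graphs N) (nonempty_unlabeled_graphs N)
          (\<lambda>U x. real (subgraph_count U x))"
    by (auto simp: natural_parameter_space_def finite_graphs[OF assms] summable_on_finite)
qed (simp add: positive_exchangeable_def exchangeable_iff_exponential_form[OF assms] cong: conj_cong)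

section \<open>Mean values\<close>

text \<open>Isomorphism is defined by permutations of all of \<open>N\<close>, whereas the counts in the mean value
  formula use maps defined on the non-isolated nodes only; this bridges the two.\<close>

lemma inj_on_extend_bij:
  assumes "finite N" "A \<subseteq> N" "f ` A \<subseteq> N" "inj_on f A"
  obtains \<pi> where "bij_betw \<pi> N N" "\<And>a. a \<in> A \<Longrightarrow> \<pi> a = f a"
proof -
  have "card (N - A) = card (N - f ` A)"
    using assms by (simp add: card_Diff_subset finite_subset card_image)
  then obtain g where g: "bij_betw g (N - A) (N - f ` A)"
    using finite_same_card_bij assms(1) by (metis finite_Diff)
  let ?pi = "\<lambda>a. if a \<in> A then f a else g a"
  have "bij_betw ?pi A (f ` A)"
    using assms(4) by (auto simp: bij_betw_def inj_on_def)
  moreover have "bij_betw ?pi (N - A) (N - f ` A)"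
    using g by (subst bij_betw_cong[where g = g]) auto
  ultimately have "bij_betw ?pi (A \<union> (N - A)) (f ` A \<union> (N - f ` A))"
    by (rule bij_betw_combine) auto
  moreover have "A \<union> (N - A) = N" "f ` A \<union> (N - f ` A) = N"
    using assms by auto
  ultimately show thesis
    by (intro that[of ?pi]) auto
qed

definition embeddings :: "'a set \<Rightarrow> 'a graph \<Rightarrow> ('a \<Rightarrow> 'a) set" where
  "embeddings N B = {f \<in> \<Union>B \<rightarrow>\<^sub>E N. inj_on f (\<Union>B)}"

text \<open>An injective map sends dyads to dyads, so the edge condition is automatic when the target
  is complete.\<close>

lemma inj_hom_count_complete:
  assumes "B \<in> graphs N"
  shows "inj_hom_count (without_isolated B) (complete_graph_on N) = card (embeddings N B)"
proof -
  have "f ` e \<in> dyads N" if "f \<in> \<Union>B \<rightarrow>\<^sub>E N" "inj_on f (\<Union>B)" "e \<in> B" for f e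
  proof -
    have "inj_on f e"
      using that(2) by (rule inj_on_subset) (use that(3) in auto)
    moreover have "card e = 2" "f ` e \<subseteq> N"
      using that assms by (auto simp: graphs_def dyads_def)
    ultimately show ?thesis
      by (simp add: dyads_def card_image)
  qed
  then show ?thesis
    unfolding inj_hom_count_def without_isolated_def complete_graph_on_def embeddings_def
    by (intro arg_cong[of _ _ card]) auto
qed

text \<open>If \<open>\<pi>\<close> is a relabelling that carries \<open>B\<close> to \<open>C\<close>, composition with \<open>\<pi>\<close> is a bijection from the
  injective endomorphisms of \<open>B\<close> to the embeddings with image \<open>C\<close>. Finiteness enters because an
  injective endomorphism maps the finite edge set \<open>B\<close> injectively into itself, hence onto
  itself.\<close>

lemma card_embeddings_onto_copy:
  assumes "finite N" "B \<in> graphs N" "(B, C) \<in> iso_rel N"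
  shows "card {f \<in> embeddings N B. (`) f ` B = C}
       = inj_hom_count (without_isolated B) (without_isolated B)"
proof -
  obtain \<pi> where pi: "bij_betw \<pi> N N" "C = (`) \<pi> ` B"
    using assms(3) by (rule iso_relE)
  have BN: "\<Union>B \<subseteq> N"
    by (rule Union_graph_subset[OF assms(2)])
  have finB: "finite B"
    by (rule finite_graph[OF assms(1,2)])
  let ?Aut = "{f \<in> \<Union>B \<rightarrow>\<^sub>E \<Union>B. inj_on f (\<Union>B) \<and> (\<forall>e\<in>B. f ` e \<in> B)}"
  let ?F = "{f \<in> embeddings N B. (`) f ` B = C}"
  have injpi: "inj_on \<pi> N" "\<pi> ` N = N"
    using pi(1) by (auto simp: bij_betw_def)
  have img: "(\<lambda>a\<in>\<Union>B. g (f a)) ` e = g ` f ` e" if "e \<in> B" for e and f g :: "'a \<Rightarrow> 'a"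
    unfolding image_image by (rule image_cong) (use that in auto)
  have "bij_betw (\<lambda>f. \<lambda>a\<in>\<Union>B. \<pi> (f a)) ?Aut ?F"
  proof (rule bij_betw_byWitness[where f' = "\<lambda>f. \<lambda>a\<in>\<Union>B. inv_into N \<pi> (f a)"])
    show "\<forall>f\<in>?Aut. (\<lambda>a\<in>\<Union>B. inv_into N \<pi> ((\<lambda>a\<in>\<Union>B. \<pi> (f a)) a)) = f"
    proof
      fix f assume f: "f \<in> ?Aut"
      have "inv_into N \<pi> (\<pi> (f a)) = f a" if "a \<in> \<Union>B" for a
      proof (rule inv_into_f_f[OF injpi(1)])
        have "f a \<in> \<Union>B"
          using f that by (blast dest: PiE_mem)
        then show "f a \<in> N"
          using BN by blast
      qed
      moreover have "f \<in> extensional (\<Union>B)"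
        using f by (auto simp: PiE_def)
      ultimately show "(\<lambda>a\<in>\<Union>B. inv_into N \<pi> ((\<lambda>a\<in>\<Union>B. \<pi> (f a)) a)) = f"
        by (intro extensionalityI[of _ "\<Union>B"]) auto
    qed
    show "\<forall>f\<in>?F. (\<lambda>a\<in>\<Union>B. \<pi> ((\<lambda>a\<in>\<Union>B. inv_into N \<pi> (f a)) a)) = f"
    proof
      fix f assume f: "f \<in> ?F"
      have "\<pi> (inv_into N \<pi> (f a)) = f a" if "a \<in> \<Union>B" for a
      proof (rule f_inv_into_f)
        show "f a \<in> \<pi> ` N"
          unfolding injpi(2) using f that by (auto simp: embeddings_def dest: PiE_mem)
      qed
      moreover have "f \<in> extensional (\<Union>B)"
        using f by (auto simp: PiE_def embeddings_def)
      ultimately show "(\<lambda>a\<in>\<Union>B. \<pi> ((\<lambda>a\<in>\<Union>B. inv_into N \<pi> (f a)) a)) = f"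
        by (intro extensionalityI[of _ "\<Union>B"]) auto
    qed
    show "(\<lambda>f. \<lambda>a\<in>\<Union>B. \<pi> (f a)) ` ?Aut \<subseteq> ?F"
    proof (rule image_subsetI)
      fix f assume f: "f \<in> ?Aut"
      let ?h = "\<lambda>a\<in>\<Union>B. \<pi> (f a)"
      have fU: "f ` \<Union>B \<subseteq> \<Union>B"
        using f by (auto dest: PiE_mem)
      have "inj_on (\<pi> \<circ> f) (\<Union>B)"
      proof (rule comp_inj_on)
        show "inj_on f (\<Union>B)"
          using f by simp
        show "inj_on \<pi> (f ` \<Union>B)"
          using injpi(1) by (rule inj_on_subset) (use fU BN in blast)
      qed
      then have "inj_on ?h (\<Union>B)"
        by (simp add: inj_on_def)
      moreover have "?h \<in> \<Union>B \<rightarrow>\<^sub>E N"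
      proof (rule PiE_I)
        fix a assume "a \<in> \<Union>B"
        then have "f a \<in> N"
          using fU BN by blast
        then show "?h a \<in> N"
          using \<open>a \<in> \<Union>B\<close> bij_betwE[OF pi(1)] by simp
      qed simp
      moreover have "(`) f ` B = B"
      proof (rule endo_inj_surj[OF finB])
        show "(`) f ` B \<subseteq> B"
          using f by auto
        have "inj_on ((`) f) (Pow (\<Union>B))"
          using f by (intro inj_on_image_Pow) auto
        then show "inj_on ((`) f) B"
          by (rule inj_on_subset) auto
      qed
      then have "(`) \<pi> ` (`) f ` B = C"
        by (simp add: pi(2))
      then have "(`) ?h ` B = C"
        using img[of _ \<pi> f] by (simp add: image_image cong: image_cong_simp)
      ultimately show "?h \<in> ?F"
        by (simp add: embeddings_def)
    qed
    show "(\<lambda>f. \<lambda>a\<in>\<Union>B. inv_into N \<pi> (f a)) ` ?F \<subseteq> ?Aut"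
    proof (rule image_subsetI)
      fix f assume f: "f \<in> ?F"
      let ?h = "\<lambda>a\<in>\<Union>B. inv_into N \<pi> (f a)"
      have fN: "f ` \<Union>B \<subseteq> N" and finj: "inj_on f (\<Union>B)" and fB: "(`) f ` B = C"
        using f by (auto simp: embeddings_def)
      have "inj_on (inv_into N \<pi>) N"
        using bij_betw_inv_into[OF pi(1)] by (simp add: bij_betw_def)
      then have "inj_on (inv_into N \<pi> \<circ> f) (\<Union>B)"
        using fN by (intro comp_inj_on[OF finj]) (rule inj_on_subset)
      then have "inj_on ?h (\<Union>B)"
        by (simp add: inj_on_def)
      moreover have edges: "?h ` e \<in> B" if e: "e \<in> B" for e
      proof -
        have "f ` e \<in> (`) \<pi> ` B"
          using e fB unfolding pi(2) by blast
        then obtain d where d: "d \<in> B" "f ` e = \<pi> ` d"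
          by auto
        have "inv_into N \<pi> ` \<pi> ` d = d"
          using d(1) BN injpi by (intro inv_into_image_cancel) auto
        then show ?thesis
          using d img[OF e, of "inv_into N \<pi>" f] by simp
      qed
      moreover have "?h \<in> \<Union>B \<rightarrow>\<^sub>E \<Union>B"
      proof (rule PiE_I)
        fix a assume "a \<in> \<Union>B"
        then obtain e where "e \<in> B" "a \<in> e"
          by auto
        with edges[of e] show "?h a \<in> \<Union>B"
          by blast
      qed simp
      ultimately show "?h \<in> ?Aut"
        by simp
    qed
  qed
  then show ?thesis
    unfolding inj_hom_count_def without_isolated_def
    by (simp add: bij_betw_same_card)
qed

lemma inj_hom_count_self_pos:
  assumes "finite N" "B \<in> graphs N"
  shows "inj_hom_count (without_isolated B) (without_isolated B) > 0"
proof -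
  let ?Aut = "{f \<in> \<Union>B \<rightarrow>\<^sub>E \<Union>B. inj_on f (\<Union>B) \<and> (\<forall>e\<in>B. f ` e \<in> B)}"
  have "finite (\<Union>B)"
    using assms Union_graph_subset finite_subset by blast
  then have "finite (\<Union>B \<rightarrow>\<^sub>E \<Union>B)"
    by (intro finite_PiE)
  then have "finite ?Aut"
    by (rule rev_finite_subset) auto
  moreover have "restrict id (\<Union>B) ` e = e" if "e \<in> B" for e
    using that by (force simp: image_def)
  then have "restrict id (\<Union>B) \<in> ?Aut"
    by (auto simp: inj_on_def)
  ultimately show ?thesis
    unfolding inj_hom_count_def without_isolated_def card_gt_0_iff fst_conv snd_conv by blast
qed

text \<open>Count the embeddings of \<open>B\<close> into \<open>N\<close> by their images. The images exhaust the class of \<open>B\<close>,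
  and all fibres have the same positive size.\<close>

lemma card_iso_class:
  assumes "finite N" "B \<in> graphs N"
  shows "real (card (iso_rel N `` {B})) =
    real (inj_hom_count (without_isolated B) (complete_graph_on N))
      / real (inj_hom_count (without_isolated B) (without_isolated B))"
proof -
  let ?U = "iso_rel N `` {B}"
  have finU: "finite ?U"
    using finite_graphs[OF assms(1)] by (rule rev_finite_subset) (auto simp: iso_rel_def)
  have BN: "\<Union>B \<subseteq> N"
    by (rule Union_graph_subset[OF assms(2)])
  then have "finite (\<Union>B \<rightarrow>\<^sub>E N)"
    using assms(1) by (intro finite_PiE) (auto intro: finite_subset)
  then have fin: "finite (embeddings N B)"
    by (rule rev_finite_subset) (auto simp: embeddings_def)
  have image: "(\<lambda>f. (`) f ` B) ` embeddings N B \<subseteq> ?U"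
  proof (rule image_subsetI)
    fix f assume "f \<in> embeddings N B"
    then have "f ` \<Union>B \<subseteq> N" "inj_on f (\<Union>B)"
      by (auto simp: embeddings_def)
    then obtain \<pi> where pi: "bij_betw \<pi> N N" "\<And>a. a \<in> \<Union>B \<Longrightarrow> \<pi> a = f a"
      using inj_on_extend_bij[OF assms(1) BN] by metis
    have "(`) f ` B = (`) \<pi> ` B"
      using pi(2) by (intro image_cong refl) (metis UnionI)
    then show "(`) f ` B \<in> ?U"
      using iso_relI[OF pi(1) assms(2)] by simp
  qed
  have "card (embeddings N B) = (\<Sum>f\<in>embeddings N B. 1)"
    by simp
  also have "\<dots> = (\<Sum>C\<in>?U. \<Sum>f\<in>{f \<in> embeddings N B. (`) f ` B = C}. 1)"
    by (rule sum.group[symmetric, OF fin finU image])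
  also have "\<dots> = (\<Sum>C\<in>?U. inj_hom_count (without_isolated B) (without_isolated B))"
    by (intro sum.cong) (auto simp: card_embeddings_onto_copy[OF assms] simp flip: card_eq_sum)
  finally show ?thesis
    using inj_hom_count_self_pos[OF assms] by (simp add: inj_hom_count_complete[OF assms(2)])
qed

text \<open>This makes \<open>z\<^sub>U\<close> well defined: the sum of \<open>P\<close> over the supergraphs of \<open>C\<close> is reindexed by a
  relabelling that carries \<open>B\<close> to \<open>C\<close>.\<close>

lemma exchangeable_prob_subgraph:
  assumes "finite N" "set_pmf P = graphs N" "exchangeable N P" "(B, C) \<in> iso_rel N"
  shows "measure_pmf.prob P {x. B \<subseteq> x} = measure_pmf.prob P {x. C \<subseteq> x}"
proof -
  obtain \<pi> where pi: "bij_betw \<pi> N N" "B \<in> graphs N" "C = (`) \<pi> ` B"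
    using assms(4) by (rule iso_relE)
  let ?r = "(`) ((`) \<pi>)"
  have prob: "measure_pmf.prob P {x. D \<subseteq> x} = (\<Sum>x\<in>graphs N. if D \<subseteq> x then pmf P x else 0)" for D
  proof -
    have "measure_pmf.prob P {x. D \<subseteq> x} = measure_pmf.prob P ({x. D \<subseteq> x} \<inter> graphs N)"
      using measure_Int_set_pmf[of P] assms(2) by simp
    also have "\<dots> = (\<Sum>x\<in>graphs N \<inter> {x. D \<subseteq> x}. pmf P x)"
      using finite_graphs[OF assms(1)] by (subst measure_measure_pmf_finite) (auto simp: Int_commute)
    finally show ?thesis
      by (simp add: sum.inter_restrict finite_graphs[OF assms(1)])
  qed
  have "(\<Sum>x\<in>graphs N. if C \<subseteq> x then pmf P x else 0)
      = (\<Sum>x\<in>graphs N. if C \<subseteq> ?r x then pmf P (?r x) else 0)"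
    by (rule sum.reindex_bij_betw[OF relabel_graphs[OF pi(1)], symmetric])
  also have "\<dots> = (\<Sum>x\<in>graphs N. if B \<subseteq> x then pmf P x else 0)"
    using relabel_subset_iff[OF pi(1,2)] exchangeableD[OF assms(3) iso_relI[OF pi(1)]]
    by (intro sum.cong) (simp_all add: pi(3))
  finally show ?thesis
    by (simp add: prob)
qed

lemma expectation_subgraph_count:
  assumes "finite N" "P \<in> positive_exchangeable N" "U \<in> nonempty_unlabeled_graphs N" "B \<in> U"
  shows "measure_pmf.expectation P (\<lambda>x. real (subgraph_count U x))
       = real (card U) * measure_pmf.prob P {x. B \<subseteq> x}"
proof -
  note U = nonempty_unlabeled_graphs_class[OF assms(3)]
  have finU: "finite U"
    using finite_graphs[OF assms(1)] by (rule rev_finite_subset) (use U(1) in auto)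
  have "real (subgraph_count U x) = (\<Sum>C\<in>U. indicator {x. C \<subseteq> x} x)" for x
  proof -
    have "(\<Sum>C\<in>U. indicator {x. C \<subseteq> x} x) = (\<Sum>C\<in>U \<inter> {C. C \<subseteq> x}. 1 :: real)"
      using finU by (simp add: sum.inter_restrict indicator_def)
    also have "U \<inter> {C. C \<subseteq> x} = {C \<in> U. C \<subseteq> x}"
      by auto
    finally show ?thesis
      by (simp add: subgraph_count_def)
  qed
  moreover have "integrable (measure_pmf P) f" for f :: "'a graph \<Rightarrow> real"
    using assms(1,2) finite_graphs[of N]
    by (intro integrable_measure_pmf_finite) (simp add: positive_exchangeable_def)
  ultimately have "measure_pmf.expectation P (\<lambda>x. real (subgraph_count U x))
      = (\<Sum>C\<in>U. measure_pmf.prob P {x. C \<subseteq> x})"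
    by (simp add: Bochner_Integration.integral_sum)
  also have "\<dots> = (\<Sum>C\<in>U. measure_pmf.prob P {x. B \<subseteq> x})"
  proof (rule sum.cong[OF refl])
    fix C assume "C \<in> U"
    then have "(C, B) \<in> iso_rel N"
      using U(3) assms(4) by blast
    then show "measure_pmf.prob P {x. C \<subseteq> x} = measure_pmf.prob P {x. B \<subseteq> x}"
      using assms by (intro exchangeable_prob_subgraph) (auto simp: positive_exchangeable_def)
  qed
  finally show ?thesis
    by simp
qed

theorem mainTheorem1:
  fixes N :: "'a set"
  assumes "finite N"
  shows
    "(\<forall>P. set_pmf P = graphs N \<longrightarrow>
        (exchangeable N P \<longleftrightarrow>
          (\<exists>\<nu> \<in> nonempty_unlabeled_graphs N \<rightarrow>\<^sub>E (UNIV :: real set). \<forall>x \<in> graphs N.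
             pmf P x =
               exp ((\<Sum>U \<in> nonempty_unlabeled_graphs N. real (subgraph_count U x) * \<nu> U)
                    - log_partition (graphs N) (nonempty_unlabeled_graphs N)
                        (\<lambda>U x. real (subgraph_count U x)) \<nu>)))) \<and>
     linear_exponential_family (graphs N) (nonempty_unlabeled_graphs N)
        (\<lambda>U x. real (subgraph_count U x))
        (nonempty_unlabeled_graphs N \<rightarrow>\<^sub>E UNIV) (positive_exchangeable N) \<and>
     regular_exponential_family (graphs N) (nonempty_unlabeled_graphs N)
        (\<lambda>U x. real (subgraph_count U x))
        (nonempty_unlabeled_graphs N \<rightarrow>\<^sub>E UNIV) (positive_exchangeable N) \<and>
     (\<forall>P \<in> positive_exchangeable N. \<forall>U \<in> nonempty_unlabeled_graphs N. \<forall>B \<in> U.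
        measure_pmf.expectation P (\<lambda>x. real (subgraph_count U x)) =
          real (inj_hom_count (without_isolated B) (complete_graph_on N))
            / real (inj_hom_count (without_isolated B) (without_isolated B))
          * measure_pmf.prob P {x. B \<subseteq> x})"
proof (intro conjI allI impI ballI)
  let ?I = "nonempty_unlabeled_graphs N" and ?t = "\<lambda>U x. real (subgraph_count U x)"
  note family = exponential_family_positive_exchangeable[OF assms]
  show "exchangeable N P \<longleftrightarrow> (\<exists>\<nu> \<in> ?I \<rightarrow>\<^sub>E UNIV. \<forall>x \<in> graphs N.
      pmf P x = exp ((\<Sum>U \<in> ?I. ?t U x * \<nu> U) - log_partition (graphs N) ?I ?t \<nu>))"
    if "set_pmf P = graphs N" for P
    by (rule exchangeable_iff_exponential_form[OF assms that])
  show "linear_exponential_family (graphs N) ?I ?t (?I \<rightarrow>\<^sub>E UNIV) (positive_exchangeable N)"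
    using family by (auto simp: linear_exponential_family_def)
  have "?I \<rightarrow>\<^sub>E UNIV = natural_parameter_space (graphs N) ?I ?t"
    by (auto simp: natural_parameter_space_def finite_graphs[OF assms] summable_on_finite)
  moreover have "openin (powertop_real ?I) (?I \<rightarrow>\<^sub>E UNIV)"
    using openin_topspace[of "powertop_real ?I"] by simp
  moreover have "\<forall>c b. (\<forall>x\<in>graphs N. (\<Sum>U\<in>?I. c U * ?t U x) = b) \<longrightarrow> (\<forall>U\<in>?I. c U = 0)"
    using subgraph_counts_affinely_independent[OF assms] by blast
  ultimately show
    "regular_exponential_family (graphs N) ?I ?t (?I \<rightarrow>\<^sub>E UNIV) (positive_exchangeable N)"
    using family by (simp add: regular_exponential_family_def)
  show "measure_pmf.expectation P (\<lambda>x. real (subgraph_count U x)) =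
      real (inj_hom_count (without_isolated B) (complete_graph_on N))
        / real (inj_hom_count (without_isolated B) (without_isolated B))
      * measure_pmf.prob P {x. B \<subseteq> x}"
    if "P \<in> positive_exchangeable N" "U \<in> ?I" "B \<in> U" for P U B
    using expectation_subgraph_count[OF assms that] card_iso_class[OF assms, of B]
      nonempty_unlabeled_graphs_class[OF that(2,3)]
    by simp
qed

end
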